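(* Let $C\subseteq\mathbb{F}_q^n$ be an $[n,k]$ code over $\mathbb{F}_q$, let $r$ be a positive integer with $r\le k$, and let $t$ be a positive integer. Then the following are equivalent: (1) for every integer $i$ with $d_r(C)\le i\le n$, the multiset $\mathcal{S}_{r,i}(C)$ forms a $t$-design; (2) the $r$-th higher Jacobi polynomial $J_{C,T}^{(r)}$ attached to a $t$-subset $T\subseteq[n]$ is independent of the choice of the $t$-subset $T$.
   Context: $q$ is a prime power, $[n]=\{1,\dots,n\}$, and $\overline{T}=[n]\setminus T$. An $[n,k]$ code over $\mathbb{F}_q$ is a $k$-dimensional $\mathbb{F}_q$-linear subspace $C$ of $\mathbb{F}_q^n$. For a linear subspace $D\subseteq\mathbb{F}_q^n$, $\mathrm{Supp}(D)=\{i\in[n] : u_i\ne 0\text{ for some }u\in D\}$, $\mathrm{wt}(D)=|\mathrm{Supp}(D)|$, and $\mathrm{wt}_S(D)=|\mathrm{Supp}(D)\cap S|$ for $S\subseteq[n]$. $\mathcal{D}_r(C)$ is the set of $r$-dimensional $\mathbb{F}_q$-subspaces of $C$. The $r$-th generalized Hamming weight is $d_r(C)=\min\{\mathrm{wt}(D) : D\in\mathcal{D}_r(C)\}$. $\mathcal{S}_{r,i}(C)$ is the multiset of supports $\mathrm{Supp}(D)$ of those $D\in\mathcal{D}_r(C)$ with $\mathrm{wt}(D)=i$ (counted with multiplicity, one for each such $D$). A collection (multiset) $\mathcal{B}$ of $i$-subsets of $[n]$ is a $t$-design if there is a number $\lambda$ such that every $t$-subset of $[n]$ is contained in exactly $\lambda$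 members of $\mathcal{B}$, counted with multiplicity (repeated blocks are allowed). The $r$-th higher Jacobi polynomial of $C$ associated to $T\subseteq[n]$ is $$J_{C,T}^{(r)}(w,z,x,y)=\sum_{i=0}^{n-|T|}\sum_{j=0}^{|T|}A_{i,j}^{(r)}(C,T)\,w^{|T|-j}z^{j}x^{n-|T|-i}y^{i},$$ where $A_{i,j}^{(r)}(C,T)=\#\{D\in\mathcal{D}_r(C) : \mathrm{wt}_{\overline{T}}(D)=i,\ \mathrm{wt}_T(D)=j\}$.
   Formalization: The implication (1) ⟹ (2) is stated only for t ≤ d_r(C), since it fails otherwise (q=2, n=3, C spanned by e_1, r=1, t=2); the implication (2) ⟹ (1) is stated for every t. *)

theory Defs
  imports
    "HOL-Analysis.Cartesian_Space"
    "HOL-Library.Multiset"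
    "HOL-Library.Poly_Mapping"
begin

text \<open>
  The field with \<open>q\<close> elements is a type \<open>'a :: {field, finite}\<close>, so \<open>q = CARD('a)\<close>; the coordinate
  set \<open>[n]\<close> is a finite type \<open>'n\<close>, so \<open>n = CARD('n)\<close> and the complement of \<open>T\<close> in \<open>[n]\<close> is \<open>- T\<close>.
\<close>

definition is_code :: "('a::{field,finite} ^ 'n) set \<Rightarrow> nat \<Rightarrow> bool" where
  "is_code C k \<longleftrightarrow> vec.subspace C \<and> vec.dim C = k"

definition Supp :: "('a::{field,finite} ^ 'n) set \<Rightarrow> 'n set" where
  "Supp D = {i. \<exists>u\<in>D. u $ i \<noteq> 0}"

definition wt :: "('a::{field,finite} ^ 'n) set \<Rightarrow> nat" where
  "wt D = card (Supp D)"

definition wt_on :: "'n set \<Rightarrow> ('a::{field,finite} ^ 'n) set \<Rightarrow> nat" where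
  "wt_on S D = card (Supp D \<inter> S)"

definition subcodes :: "nat \<Rightarrow> ('a::{field,finite} ^ 'n) set \<Rightarrow> ('a ^ 'n) set set" where
  "subcodes r C = {D. vec.subspace D \<and> D \<subseteq> C \<and> vec.dim D = r}"

definition gen_hamming_weight :: "nat \<Rightarrow> ('a::{field,finite} ^ 'n) set \<Rightarrow> nat" where
  "gen_hamming_weight r C = Min (wt ` subcodes r C)"

definition support_mset :: "nat \<Rightarrow> nat \<Rightarrow> ('a::{field,finite} ^ 'n) set \<Rightarrow> 'n set multiset" where
  "support_mset r i C = image_mset Supp (mset_set {D \<in> subcodes r C. wt D = i})"

text \<open>
  Repeated blocks are allowed, \<open>\<B>\<close> may be empty, and the block size \<open>i\<close> is not required to be at
  least \<open>t\<close>: for \<open>i < t\<close> no \<open>t\<close>-subset lies in a block, so the condition holds with \<open>l = 0\<close>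
  and says nothing about how the blocks meet a \<open>t\<close>-subset.
\<close>

definition is_design :: "nat \<Rightarrow> nat \<Rightarrow> 'n::finite set multiset \<Rightarrow> bool" where
  "is_design t i \<B> \<longleftrightarrow> (\<forall>B\<in>#\<B>. card B = i) \<and>
     (\<exists>l::nat. \<forall>T. card T = t \<longrightarrow> size (filter_mset (\<lambda>B. T \<subseteq> B) \<B>) = l)"

definition A_coeff :: "nat \<Rightarrow> ('a::{field,finite} ^ 'n) set \<Rightarrow> 'n set \<Rightarrow> nat \<Rightarrow> nat \<Rightarrow> nat" where
  "A_coeff r C T i j = card {D \<in> subcodes r C. wt_on (- T) D = i \<and> wt_on T D = j}"

text \<open>
  Formal polynomials over the integers in four indeterminates: finitely supported maps from
  monomials (finitely supported exponent functions) to coefficients, with the convolution product.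
\<close>

datatype jvar = W | Z | X | Y

type_synonym jpoly = "(jvar \<Rightarrow>\<^sub>0 nat) \<Rightarrow>\<^sub>0 int"

definition var :: "jvar \<Rightarrow> jpoly" where
  "var v = Poly_Mapping.single (Poly_Mapping.single v 1) 1"

definition jacobi_poly :: "nat \<Rightarrow> ('a::{field,finite} ^ 'n) set \<Rightarrow> 'n set \<Rightarrow> jpoly" where
  "jacobi_poly r C T =
     (\<Sum>i = 0..CARD('n) - card T. \<Sum>j = 0..card T.
        of_nat (A_coeff r C T i j) * var W ^ (card T - j) * var Z ^ j
          * var X ^ (CARD('n) - card T - i) * var Y ^ i)"

definition supports_form_designs :: "nat \<Rightarrow> nat \<Rightarrow> ('a::{field,finite} ^ 'n) set \<Rightarrow> bool" where
  "supports_form_designs r t C \<longleftrightarrow>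
     (\<forall>i. gen_hamming_weight r C \<le> i \<and> i \<le> CARD('n) \<longrightarrow> is_design t i (support_mset r i C))"

definition jacobi_independent :: "nat \<Rightarrow> nat \<Rightarrow> ('a::{field,finite} ^ 'n) set \<Rightarrow> bool" where
  "jacobi_independent r t C \<longleftrightarrow>
     (\<forall>T T' :: 'n set. card T = t \<and> card T' = t \<longrightarrow> jacobi_poly r C T = jacobi_poly r C T')"

end

theory Submission
  imports Defs
begin

text \<open>
  The monomials \<open>w\<^bsup>t-j\<^esup> z\<^bsup>j\<^esup> x\<^bsup>n-t-i\<^esup> y\<^bsup>i\<^esup>\<close> are pairwise distinct, so the Jacobi polynomial of a
  \<open>t\<close>-subset \<open>T\<close> carries exactly the numbers \<open>A_coeff r C T i j\<close> (lemma \<open>jacobi_poly_eq_iff\<close>).  Such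
  a number counts the \<open>r\<close>-dimensional subcodes of weight \<open>i + j\<close> whose support meets \<open>T\<close> in
  \<open>j\<close> points (lemma \<open>A_coeff_eq_card_meet\<close>).  The equivalence is therefore one between designs and
  intersection numbers.

  From the Jacobi polynomial to designs: a support contains \<open>T\<close> iff it meets \<open>T\<close> in \<open>t\<close> points,
  so the number of supports of size \<open>i\<close> through \<open>T\<close> is the coefficient \<open>A_coeff r C T (i - t) t\<close>, or
  \<open>0\<close> if \<open>i < t\<close>.

  From designs to the Jacobi polynomial: a \<open>t\<close>-design with blocks of size \<open>i \<ge> t\<close> is also an
  \<open>s\<close>-design for each \<open>s \<le> t\<close> (lemma \<open>card_blocks_through_smaller_eq\<close>); this is where
  \<open>t \<le> gen_hamming_weight r C\<close> enters, since it makes all the supports that occur that large.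
  Counting pairs of an \<open>s\<close>-subset of \<open>T\<close> and a block containing it shows that the numbers \<open>n\<^sub>j\<close> of
  blocks meeting \<open>T\<close> in \<open>j\<close> points satisfy \<open>\<Sum>j\<le>t. n\<^sub>j * (j choose s) = (t choose s) * \<lambda>\<^sub>s\<close> for
  \<open>s \<le> t\<close>, where \<open>\<lambda>\<^sub>s\<close> is the number of blocks through an \<open>s\<close>-set.  This system is unitriangular, so it
  determines the \<open>n\<^sub>j\<close> independently of \<open>T\<close> (lemma \<open>card_blocks_meeting_eq\<close>).
\<close>

section \<open>Intersection numbers of designs\<close>

text \<open>
  Families of blocks are given by a finite index set \<open>I\<close> and a map \<open>f\<close> into sets of points, which
  accounts for repeated blocks.
\<close>

lemma sum_binomial_unitriangular:
  fixes a b :: "nat \<Rightarrow> nat"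
  assumes "\<And>s. s \<le> t \<Longrightarrow> (\<Sum>j\<le>t. a j * (j choose s)) = (\<Sum>j\<le>t. b j * (j choose s))"
    and "j \<le> t"
  shows "a j = b j"
  using assms
proof (induction t arbitrary: j)
  case 0
  then show ?case by simp
next
  case (Suc t)
  \<comment> \<open>In the equation for \<open>s = Suc t\<close> only the term \<open>j = Suc t\<close> survives.\<close>
  have top: "a (Suc t) = b (Suc t)"
    using Suc.prems(1)[of "Suc t"] by (simp add: binomial_eq_0)
  have "(\<Sum>j\<le>t. a j * (j choose s)) = (\<Sum>j\<le>t. b j * (j choose s))" if "s \<le> t" for s
    using Suc.prems(1)[of s] that top by simp
  then show ?case
    using Suc.IH[of j] Suc.prems(2) top by (cases "j = Suc t") auto
qed

text \<open>A superset \<open>T\<close> of \<open>S\<close> inside \<open>B\<close> is given by the subset \<open>T - S\<close> of \<open>B - S\<close>.\<close>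

lemma card_supersets_within:
  assumes "finite B" "S \<subseteq> B" "card S \<le> t"
  shows "card {T. S \<subseteq> T \<and> T \<subseteq> B \<and> card T = t} = (card B - card S) choose (t - card S)"
proof -
  have finS: "finite S"
    using assms finite_subset by blast
  have "bij_betw (\<lambda>U. S \<union> U) {U. U \<subseteq> B - S \<and> card U = t - card S}
          {T. S \<subseteq> T \<and> T \<subseteq> B \<and> card T = t}"
  proof (rule bij_betwI[where g = "\<lambda>T. T - S"])
    show "(\<lambda>U. S \<union> U) \<in> {U. U \<subseteq> B - S \<and> card U = t - card S} \<rightarrow>
        {T. S \<subseteq> T \<and> T \<subseteq> B \<and> card T = t}"
    proof (intro funcsetI CollectI conjI)
      fix U assume U: "U \<in> {U. U \<subseteq> B - S \<and> card U = t - card S}"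
      then have "finite U" "S \<inter> U = {}"
        using assms(1) finite_subset by blast+
      then show "card (S \<union> U) = t"
        using U assms(3) finS by (simp add: card_Un_disjoint)
    qed (use assms(2) in auto)
    show "(\<lambda>T. T - S) \<in> {T. S \<subseteq> T \<and> T \<subseteq> B \<and> card T = t} \<rightarrow>
        {U. U \<subseteq> B - S \<and> card U = t - card S}"
      by (auto simp: card_Diff_subset finS)
  qed auto
  then have "card {T. S \<subseteq> T \<and> T \<subseteq> B \<and> card T = t} = card {U. U \<subseteq> B - S \<and> card U = t - card S}"
    by (rule bij_betw_same_card[symmetric])
  also have "\<dots> = (card B - card S) choose (t - card S)"
    using assms(1,2) finS by (simp add: n_subsets card_Diff_subset)
  finally show ?thesis .
qed

text \<open>
  The number of blocks through \<open>S\<close> is recovered from the numbers of blocks through the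
  \<open>t\<close>-supersets of \<open>S\<close>, because each block through \<open>S\<close> contains the same number of them, and this
  number is positive if the block size is at least \<open>t\<close>.
\<close>

lemma card_blocks_through_smaller:
  fixes f :: "'d \<Rightarrow> 'n::finite set"
  assumes "finite I"
    and size: "\<And>D. D \<in> I \<Longrightarrow> card (f D) = i"
    and design: "\<And>T. card T = t \<Longrightarrow> card {D \<in> I. T \<subseteq> f D} = l"
    and "card S \<le> t"
  shows "card {D \<in> I. S \<subseteq> f D} * ((i - card S) choose (t - card S)) =
         l * ((CARD('n) - card S) choose (t - card S))"
proof -
  let ?P = "{T. S \<subseteq> T \<and> T \<subseteq> UNIV \<and> card T = t}"
  let ?c = "(i - card S) choose (t - card S)"
  have "(\<Sum>T\<in>?P. card {D \<in> I. T \<subseteq> f D}) = (\<Sum>D\<in>I. if S \<subseteq> f D then ?c else 0)"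
  proof (rule sum_multicount_gen)
    show "\<forall>D\<in>I. card {T \<in> ?P. T \<subseteq> f D} = (if S \<subseteq> f D then ?c else 0)"
    proof
      fix D assume D: "D \<in> I"
      show "card {T \<in> ?P. T \<subseteq> f D} = (if S \<subseteq> f D then ?c else 0)"
      proof (cases "S \<subseteq> f D")
        case True
        have "{T \<in> ?P. T \<subseteq> f D} = {T. S \<subseteq> T \<and> T \<subseteq> f D \<and> card T = t}" by auto
        then show ?thesis
          using True card_supersets_within[of "f D" S t] size[OF D] \<open>card S \<le> t\<close> by simp
      next
        case False
        then have "{T \<in> ?P. T \<subseteq> f D} = {}" by auto
        then show ?thesis
          using False by simp
      qed
    qed
  qed (use \<open>finite I\<close> in auto)
  moreover have "(\<Sum>D\<in>I. if S \<subseteq> f D then ?c else 0) = card {D \<in> I. S \<subseteq> f D} * ?c"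
    using \<open>finite I\<close> by (simp add: sum.inter_filter[symmetric])
  moreover have "(\<Sum>T\<in>?P. card {D \<in> I. T \<subseteq> f D}) = card ?P * l"
    using design by simp
  moreover have "card ?P = (CARD('n) - card S) choose (t - card S)"
    using card_supersets_within[of UNIV S t] \<open>card S \<le> t\<close> by simp
  ultimately show ?thesis
    by (simp add: mult.commute)
qed

lemma card_blocks_through_smaller_eq:
  fixes f :: "'d \<Rightarrow> 'n::finite set"
  assumes "finite I"
    and "\<And>D. D \<in> I \<Longrightarrow> card (f D) = i"
    and "\<And>T. card T = t \<Longrightarrow> card {D \<in> I. T \<subseteq> f D} = l"
    and "t \<le> i" "card S \<le> t" "card S' = card S"
  shows "card {D \<in> I. S \<subseteq> f D} = card {D \<in> I. S' \<subseteq> f D}"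
proof -
  have "(i - card S) choose (t - card S) > 0"
    using \<open>t \<le> i\<close> by (simp add: diff_le_mono)
  moreover have "card {D \<in> I. S \<subseteq> f D} * ((i - card S) choose (t - card S)) =
      card {D \<in> I. S' \<subseteq> f D} * ((i - card S) choose (t - card S))"
    using card_blocks_through_smaller[OF assms(1-3), where S = S]
      card_blocks_through_smaller[OF assms(1-3), where S = S'] assms(5,6) by simp
  ultimately show ?thesis by simp
qed

text \<open>Both sides count the pairs of a block and an \<open>s\<close>-subset of \<open>T\<close> contained in it.\<close>

lemma sum_meeting_binomial:
  fixes f :: "'d \<Rightarrow> 'n::finite set"
  assumes "finite I"
  shows "(\<Sum>j\<le>card T. card {D \<in> I. card (f D \<inter> T) = j} * (j choose s)) =
         (\<Sum>S | S \<subseteq> T \<and> card S = s. card {D \<in> I. S \<subseteq> f D})"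
proof -
  have "(\<Sum>S | S \<subseteq> T \<and> card S = s. card {D \<in> I. S \<subseteq> f D}) =
      (\<Sum>D\<in>I. card (f D \<inter> T) choose s)"
  proof (rule sum_multicount_gen)
    show "\<forall>D\<in>I. card {S \<in> {S. S \<subseteq> T \<and> card S = s}. S \<subseteq> f D} = (card (f D \<inter> T) choose s)"
    proof
      fix D
      have "{S \<in> {S. S \<subseteq> T \<and> card S = s}. S \<subseteq> f D} = {S. S \<subseteq> f D \<inter> T \<and> card S = s}" by auto
      then show "card {S \<in> {S. S \<subseteq> T \<and> card S = s}. S \<subseteq> f D} = (card (f D \<inter> T) choose s)"
        by (simp only: n_subsets[OF finite])
    qed
  qed (use assms in auto)
  also have "\<dots> = (\<Sum>j\<le>card T. \<Sum>D | D \<in> I \<and> card (f D \<inter> T) = j. card (f D \<inter> T) choose s)"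
    by (rule sum.group[symmetric]) (use assms in \<open>auto intro: card_mono\<close>)
  also have "\<dots> = (\<Sum>j\<le>card T. card {D \<in> I. card (f D \<inter> T) = j} * (j choose s))"
    by (intro sum.cong) auto
  finally show ?thesis by simp
qed

text \<open>
  By \<open>card_blocks_through_smaller_eq\<close> every summand on the right-hand side of
  \<open>sum_meeting_binomial\<close> depends on \<open>s\<close> only, so for \<open>T\<close> and \<open>T'\<close> the two sequences of intersection
  numbers solve the same unitriangular system.
\<close>

lemma card_blocks_meeting_eq:
  fixes f :: "'d \<Rightarrow> 'n::finite set"
  assumes "finite I"
    and size: "\<And>D. D \<in> I \<Longrightarrow> card (f D) = i"
    and design: "\<And>T. card T = t \<Longrightarrow> card {D \<in> I. T \<subseteq> f D} = l"
    and "t \<le> i" "card T = t" "card T' = t" "j \<le> t"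
  shows "card {D \<in> I. card (f D \<inter> T) = j} = card {D \<in> I. card (f D \<inter> T') = j}"
proof -
  define N where "N U j = card {D \<in> I. card (f D \<inter> U) = j}" for U j
  \<comment> \<open>The number of blocks through an \<open>s\<close>-set does not depend on the set, so any choice will do.\<close>
  define through where "through s = card {D \<in> I. (SOME S. card S = s) \<subseteq> f D}" for s
  have "(\<Sum>j\<le>t. N U j * (j choose s)) = (t choose s) * through s" if "s \<le> t" "card U = t" for s U
  proof -
    have "card {D \<in> I. S \<subseteq> f D} = through s" if "S \<subseteq> U \<and> card S = s" for S
      unfolding through_def
    proof (rule card_blocks_through_smaller_eq[OF \<open>finite I\<close> size design \<open>t \<le> i\<close>])
      show "card (SOME S::'n set. card S = s) = card S"
        using that by (metis (mono_tags, lifting) someI)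
    qed (use that \<open>s \<le> t\<close> in auto)
    then show ?thesis
      using sum_meeting_binomial[OF \<open>finite I\<close>, where T = U and f = f and s = s] \<open>card U = t\<close>
      by (simp add: N_def n_subsets)
  qed
  then have "N T j = N T' j"
    using sum_binomial_unitriangular[of t "N T" "N T'" j] assms(5-7) by simp
  then show ?thesis
    by (simp add: N_def)
qed

section \<open>Coefficients of the Jacobi polynomial\<close>

lemma var_power: "var v ^ m = Poly_Mapping.single (Poly_Mapping.single v m) 1"
  by (induction m) (auto simp: var_def mult_single single_add[symmetric])

definition jmonom :: "nat \<Rightarrow> nat \<Rightarrow> nat \<Rightarrow> nat \<Rightarrow> (jvar \<Rightarrow>\<^sub>0 nat)" where
  "jmonom a b c d = Poly_Mapping.single W a + Poly_Mapping.single Z b +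
     Poly_Mapping.single X c + Poly_Mapping.single Y d"

lemma of_nat_mult_var_powers:
  "of_nat m * var W ^ a * var Z ^ b * var X ^ c * var Y ^ d =
     Poly_Mapping.single (jmonom a b c d) (int m)"
proof -
  have "(of_nat m :: jpoly) = Poly_Mapping.single 0 (int m)"
    by simp
  then show ?thesis
    by (simp only: var_power mult_single jmonom_def) (simp add: add.assoc)
qed

lemma jmonom_eq_iff: "jmonom a b c d = jmonom a' b' c' d' \<longleftrightarrow> a = a' \<and> b = b' \<and> c = c' \<and> d = d'"
proof
  assume eq: "jmonom a b c d = jmonom a' b' c' d'"
  have "Poly_Mapping.lookup (jmonom a b c d) v = Poly_Mapping.lookup (jmonom a' b' c' d') v" for v
    using eq by simp
  from this[of W] this[of Z] this[of X] this[of Y]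
  show "a = a' \<and> b = b' \<and> c = c' \<and> d = d'"
    by (simp add: jmonom_def lookup_add lookup_single)
qed simp

lemma lookup_jacobi_poly:
  fixes C :: "('a::{field,finite} ^ 'n) set"
  assumes "i \<le> CARD('n) - card T" "j \<le> card T"
  shows "Poly_Mapping.lookup (jacobi_poly r C T) (jmonom (card T - j) j (CARD('n) - card T - i) i) =
         int (A_coeff r C T i j)"
proof -
  have "Poly_Mapping.lookup (jacobi_poly r C T) (jmonom (card T - j) j (CARD('n) - card T - i) i) =
     (\<Sum>i' = 0..CARD('n) - card T. \<Sum>j' = 0..card T.
        if i' = i \<and> j' = j then int (A_coeff r C T i' j') else 0)"
    unfolding jacobi_poly_def of_nat_mult_var_powers
    by (auto simp: lookup_sum lookup_single jmonom_eq_iff when_def intro!: sum.cong)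
  also have "\<dots> = (\<Sum>i' = 0..CARD('n) - card T. if i' = i then int (A_coeff r C T i' j) else 0)"
    using assms by (intro sum.cong) (auto simp: sum.delta)
  also have "\<dots> = int (A_coeff r C T i j)"
    using assms by simp
  finally show ?thesis .
qed

lemma jacobi_poly_eq_iff:
  fixes C :: "('a::{field,finite} ^ 'n) set"
  assumes "card T = t" "card T' = t"
  shows "jacobi_poly r C T = jacobi_poly r C T' \<longleftrightarrow>
         (\<forall>i j. i \<le> CARD('n) - t \<and> j \<le> t \<longrightarrow> A_coeff r C T i j = A_coeff r C T' i j)"
proof
  assume eq: "jacobi_poly r C T = jacobi_poly r C T'"
  show "\<forall>i j. i \<le> CARD('n) - t \<and> j \<le> t \<longrightarrow> A_coeff r C T i j = A_coeff r C T' i j"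
    using lookup_jacobi_poly[of _ T _ r C] lookup_jacobi_poly[of _ T' _ r C] eq assms
    by (metis of_nat_eq_iff)
next
  assume "\<forall>i j. i \<le> CARD('n) - t \<and> j \<le> t \<longrightarrow> A_coeff r C T i j = A_coeff r C T' i j"
  then show "jacobi_poly r C T = jacobi_poly r C T'"
    unfolding jacobi_poly_def using assms by (intro sum.cong) auto
qed

section \<open>Supports of subcodes as blocks\<close>

text \<open>
  Sorting the subcodes by total weight instead of the weight outside \<open>T\<close> makes the counted
  supports the blocks of a single multiset \<open>support_mset r (i + j) C\<close>.
\<close>

lemma A_coeff_eq_card_meet:
  fixes C :: "('a::{field,finite} ^ 'n) set"
  shows "A_coeff r C T i j = card {D \<in> {D \<in> subcodes r C. wt D = i + j}. card (Supp D \<inter> T) = j}"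
proof -
  have "wt D = wt_on (- T) D + card (Supp D \<inter> T)" for D :: "('a ^ 'n) set"
  proof -
    have "Supp D = (Supp D \<inter> - T) \<union> (Supp D \<inter> T)" by auto
    then show ?thesis
      unfolding wt_def wt_on_def
      using card_Un_disjoint[of "Supp D \<inter> - T" "Supp D \<inter> T"] by (simp add: disjoint_iff)
  qed
  then have "{D \<in> subcodes r C. wt_on (- T) D = i \<and> wt_on T D = j} =
      {D \<in> {D \<in> subcodes r C. wt D = i + j}. card (Supp D \<inter> T) = j}"
    by (auto simp: wt_on_def)
  then show ?thesis
    by (simp add: A_coeff_def)
qed

lemma is_design_support_mset_iff:
  "is_design t i (support_mset r i C) \<longleftrightarrow>
     (\<exists>l. \<forall>T. card T = t \<longrightarrow> card {D \<in> {D \<in> subcodes r C. wt D = i}. T \<subseteq> Supp D} = l)"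
  by (auto simp: is_design_def support_mset_def wt_def filter_mset_image_mset filter_mset_mset_set)

lemma gen_hamming_weight_le:
  assumes "D \<in> subcodes r C"
  shows "gen_hamming_weight r C \<le> wt D"
  unfolding gen_hamming_weight_def using assms by (intro Min_le) auto

text \<open>
  Coefficients with \<open>i + j < gen_hamming_weight r C\<close> vanish for every \<open>T\<close>; for the others the
  supports of size \<open>i + j\<close> form a design with blocks of size at least \<open>t\<close>.
\<close>

lemma jacobi_independent_if_supports_form_designs:
  fixes C :: "('a::{field,finite} ^ 'n) set"
  assumes "t \<le> gen_hamming_weight r C" "supports_form_designs r t C"
  shows "jacobi_independent r t C"
  unfolding jacobi_independent_def
proof (intro allI impI)
  fix T T' :: "'n set"
  assume T: "card T = t \<and> card T' = t"
  have "A_coeff r C T i j = A_coeff r C T' i j" if ij: "i \<le> CARD('n) - t" "j \<le> t" for i j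
  proof (cases "gen_hamming_weight r C \<le> i + j")
    case True
    have "t \<le> CARD('n)"
      using T card_mono[of UNIV T] by auto
    then have "is_design t (i + j) (support_mset r (i + j) C)"
      using assms(2) True ij by (simp add: supports_form_designs_def)
    then obtain l where
      "\<And>T. card T = t \<Longrightarrow> card {D \<in> {D \<in> subcodes r C. wt D = i + j}. T \<subseteq> Supp D} = l"
      unfolding is_design_support_mset_iff by blast
    then show ?thesis
      unfolding A_coeff_eq_card_meet
      by (intro card_blocks_meeting_eq[where i = "i + j" and t = t and l = l])
        (use T ij True assms(1) in \<open>auto simp: wt_def\<close>)
  next
    case False
    then have "{D \<in> subcodes r C. wt D = i + j} = {}"
      by (auto dest!: gen_hamming_weight_le)
    then show ?thesis
      unfolding A_coeff_eq_card_meet by (simp only:) simp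
  qed
  then show "jacobi_poly r C T = jacobi_poly r C T'"
    using T by (simp add: jacobi_poly_eq_iff)
qed

text \<open>
  The extreme coefficients \<open>j = t\<close> suffice: a support meets \<open>T\<close> in \<open>t\<close> points iff it contains \<open>T\<close>.
\<close>

lemma supports_form_designs_if_jacobi_independent:
  fixes C :: "('a::{field,finite} ^ 'n) set"
  assumes "jacobi_independent r t C"
  shows "supports_form_designs r t C"
  unfolding supports_form_designs_def is_design_support_mset_iff
proof (intro allI impI)
  fix i assume i: "gen_hamming_weight r C \<le> i \<and> i \<le> CARD('n)"
  define N where "N T = card {D \<in> {D \<in> subcodes r C. wt D = i}. T \<subseteq> Supp D}" for T
  have N: "N T = (if t \<le> i then A_coeff r C T (i - t) t else 0)" if T: "card T = t" for T
  proof (cases "t \<le> i")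
    case True
    have "T \<subseteq> Supp D \<longleftrightarrow> card (Supp D \<inter> T) = t" for D :: "('a ^ 'n) set"
      using T by (metis card_subset_eq finite inf.absorb_iff2 inf_le2)
    then show ?thesis
      using True by (simp add: N_def A_coeff_eq_card_meet)
  next
    case False
    then have "\<not> T \<subseteq> Supp D" if "wt D = i" for D :: "('a ^ 'n) set"
      using that T card_mono[of "Supp D" T] by (auto simp: wt_def)
    then have "{D \<in> {D \<in> subcodes r C. wt D = i}. T \<subseteq> Supp D} = {}" by auto
    then show ?thesis
      using False by (simp only: N_def) simp
  qed
  have "N T = N T'" if T: "card T = t" "card T' = t" for T T'
  proof (cases "t \<le> i")
    case True
    have "jacobi_poly r C T = jacobi_poly r C T'"
      using assms T unfolding jacobi_independent_def by blast
    then have "A_coeff r C T (i - t) t = A_coeff r C T' (i - t) t"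
      using jacobi_poly_eq_iff[OF T, of r C] i by (meson diff_le_mono order_refl)
    then show ?thesis
      using True N T by simp
  qed (simp add: N T)
  then have "card T = t \<longrightarrow> N T = N (SOME T. card T = t)" for T
    by (metis (mono_tags, lifting) someI)
  then show "\<exists>l. \<forall>T. card T = t \<longrightarrow> card {D \<in> {D \<in> subcodes r C. wt D = i}. T \<subseteq> Supp D} = l"
    unfolding N_def by blast
qed

theorem theorem5p1:
  fixes C :: "('a::{field,finite} ^ 'n) set"
    and k r t :: nat
  assumes "is_code C k"
    and "1 \<le> r" and "r \<le> k"
    and "1 \<le> t"
  shows "(t \<le> gen_hamming_weight r C \<longrightarrow>
            (supports_form_designs r t C \<longleftrightarrow> jacobi_independent r t C)) \<and>
         (jacobi_independent r t C \<longrightarrow> supports_form_designs r t C)"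
  using jacobi_independent_if_supports_form_designs supports_form_designs_if_jacobi_independent
  by blast

end
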